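(* Let $X=(X,\leq)$ and $Z=(Z,\leq)$ be preordered vector spaces with $C=\{c\in X: c\geq 0\}$, $K=\{k\in Z: k\geq 0\}$, and assume $\hat C=C\setminus(-C)\neq\emptyset$ and $\hat K=K\setminus(-K)\neq\emptyset$. (1) The inverse $F^{-1}$ of any increasing left-continuous function $F\colon X\to\mathcal K(Z,K)$ is an increasing right-continuous function from $Z$ to $\mathcal K(X,-C)$. Conversely, the inverse $G^{-1}$ of any increasing right-continuous function $G\colon Z\to\mathcal K(X,-C)$ is an increasing left-continuous function from $X$ to $\mathcal K(Z,K)$. (2) For any increasing left-continuous function $F\colon X\to\mathcal K(Z,K)$ and any increasing right-continuous function $G\colon Z\to\mathcal K(X,-C)$, it holds $F=(F^{-1})^{-1}$ and $G=(G^{-1})^{-1}$. (3) If moreover $G=F^{-1}$, then for all $x\in X$ and $z\in Z$: $$F(x)\leqslant z\ \text{ if and only if }\ x\eqslantless G(z),\qquad\text{and}\qquad F^+(x)<z\ \text{ if and only if }\ x<G^-(z).$$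
   Context: A preordered vector space is a real vector space with a reflexive transitive relation $\leq$ such that $x\leq y$ iff $\lambda x+z\leq\lambda y+z$ for all $\lambda>0$ and all vectors $z$. Its cone $K$ of elements $\geq 0$ is convex and $x\leq y$ iff $y-x\in K$. Put $\hat K:=K\setminus(-K)$ and write $x<y$ iff $y-x\in\hat K$ (similarly in $X$ with $C,\hat C$). $\mathcal P(Z,K)=\{A\subseteq Z: A+K=A\}$ (with $\emptyset+K=\emptyset$), ordered by $A\leqslant B\iff A\supseteq B$. For $A\subseteq Z$, $A^\bullet:=\{z\in Z: z+\hat K\subseteq A\}$, and $\mathcal K(Z,K)=\{A\in\mathcal P(Z,K): A^\bullet=A\}$, a complete lattice with $\inf A_i=(\bigcup A_i)^\bullet$, $\sup A_i=\bigcap A_i$. $\mathcal P(X,-C)=\{B\subseteq X: B-C=B\}$, ordered by $A\eqslantless B\iff A\subseteq B$; here $B^\bullet:=\{x\in X: x-\hat C\subseteq B\}$ and $\mathcal K(X,-C)=\{B\in\mathcal P(X,-C): B^\bullet=B\}$, a complete lattice with $\inf B_i=\bigcap B_i$, $\sup B_i=(\bigcup B_i)^\bullet$. For $A\in\mathcal P(Z,K)$ and $z\in Z$: $A\leqslant z$ means $z\in A$; $A<z$ means $\tilde z\in A$ for some $\tilde z<z$. For $B\in\mathcal P(X,-C)$ and $x\in X$: $x\eqslantless B$ means $x\in B$; $x<B$ means $\tilde x\in B$ for some $\tilde x>x$. $F\colon X\to\mathcal K(Z,K)$ is increasing if $x\leq y$ implies $F(x)\leqslant F(y)$; $G\colon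 Z\to\mathcal K(X,-C)$ is increasing if $z_1\leq z_2$ implies $G(z_1)\eqslantless G(z_2)$. For an increasing function $H$ (either type), $H^-(u):=\sup_{v<u}H(v)$ and $H^+(u):=\inf_{u<v}H(v)$, with sup and inf in the respective lattice $\mathcal K$; $H$ is left-continuous if $H=H^-$ and right-continuous if $H=H^+$. Inverses: $F^{-1}(z):=\{x\in X: z\in F(x)\}$ and $G^{-1}(x):=\{z\in Z: x\in G(z)\}$. *)

theory Defs
  imports Complex_Main "HOL-Library.FuncSet" "HOL-Library.Set_Algebras"
begin

text \<open>Throughout, \<open>A + K\<close> is the Minkowski sum of sets (from \<open>Set_Algebras\<close>), whereas \<open>-\<close>
  between sets remains set difference; the Minkowski negative is written \<open>uminus ` C\<close>.\<close>

definition strict_part :: "'a::ab_group_add set \<Rightarrow> 'a set"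
  where "strict_part K = K - uminus ` K"

lemma uminus_image_iff: "x \<in> uminus ` K \<longleftrightarrow> - x \<in> K" for x :: "'a::ab_group_add"
  by force

lemma strict_part_iff: "x \<in> strict_part K \<longleftrightarrow> x \<in> K \<and> - x \<notin> K"
  by (simp add: strict_part_def uminus_image_iff)

text \<open>The library's \<open>ordered_real_vector\<close> presupposes antisymmetry, which is not wanted here.\<close>

class preordered_real_vector = real_vector + ord +
  assumes pv_refl: "x \<le> x"
    and pv_trans: "x \<le> y \<Longrightarrow> y \<le> z \<Longrightarrow> x \<le> z"
    and pv_le_iff: "x \<le> y \<longleftrightarrow> (\<forall>(r::real)>0. \<forall>z. r *\<^sub>R x + z \<le> r *\<^sub>R y + z)"
    and pv_less_iff: "x < y \<longleftrightarrow> y - x \<in> {k. 0 \<le> k} - uminus ` {k. 0 \<le> k}"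
begin

lemma pv_add_right_mono: "x \<le> y \<Longrightarrow> x + z \<le> y + z"
  using pv_le_iff[of x y] by (metis scaleR_one zero_less_one)

lemma pv_scaleR_mono: "0 < r \<Longrightarrow> x \<le> y \<Longrightarrow> r *\<^sub>R x \<le> r *\<^sub>R y"
  using pv_le_iff[of x y] by (metis add_0_right)

lemma pv_le_iff_cone: "x \<le> y \<longleftrightarrow> y - x \<in> {k. 0 \<le> k}"
  using pv_add_right_mono[of x y "- x"] pv_add_right_mono[of 0 "y - x" x] by auto

subclass preorder
proof
  fix x y z
  have "x - y \<in> {k. 0 \<le> k} \<longleftrightarrow> y - x \<in> uminus ` {k. 0 \<le> k}"
    by (auto simp: image_iff) (metis minus_diff_eq minus_minus)+
  then show "x < y \<longleftrightarrow> x \<le> y \<and> \<not> y \<le> x"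
    unfolding pv_less_iff using pv_le_iff_cone[of x y] pv_le_iff_cone[of y x]
    by auto
qed (fact pv_refl pv_trans)+

end

text \<open>The families \<open>\<P>(Z, K)\<close> and \<open>\<K>(Z, K)\<close>.  Those for \<open>X\<close> are the instances with \<open>-C\<close> in
  place of \<open>K\<close>; see \<open>mono_sets_uminus\<close> and \<open>bullet_uminus\<close> below.\<close>

definition mono_sets :: "'a::ab_group_add set \<Rightarrow> 'a set set"
  where "mono_sets K = {A. A + K = A}"

definition bullet :: "'a::ab_group_add set \<Rightarrow> 'a set \<Rightarrow> 'a set"
  where "bullet K A = {z. {z} + strict_part K \<subseteq> A}"

definition closed_sets :: "'a::ab_group_add set \<Rightarrow> 'a set set"
  where "closed_sets K = {A \<in> mono_sets K. bullet K A = A}"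

lemma mono_sets_uminus:
  "mono_sets (uminus ` C) = {B. {b - c | b c. b \<in> B \<and> c \<in> C} = B}"
proof -
  have "B + uminus ` C = {b - c | b c. b \<in> B \<and> c \<in> C}" for B :: "'a set"
    by (auto simp: set_plus_def)
  then show ?thesis by (simp add: mono_sets_def)
qed

lemma strict_part_uminus: "strict_part (uminus ` C) = uminus ` strict_part C"
  by (auto simp: strict_part_iff uminus_image_iff)

lemma bullet_uminus: "bullet (uminus ` C) B = {x. \<forall>c\<in>strict_part C. x - c \<in> B}"
  by (auto simp: bullet_def strict_part_uminus set_plus_def)

text \<open>\<open>\<K>(Z, K)\<close> is ordered by \<open>\<supseteq>\<close> and \<open>\<K>(X, -C)\<close> by \<open>\<subseteq>\<close>.  The suffixes \<open>Z\<close> and \<open>X\<close> refer to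
  these two lattices; the argument \<open>D\<close> in the second case stands for \<open>-C\<close>.  The lemmas
  \<open>inf_Z_greatest\<close> to \<open>sup_X_least\<close> below confirm that these are the lattice operations.\<close>

definition inf_Z :: "'z::ab_group_add set \<Rightarrow> 'z set set \<Rightarrow> 'z set"
  where "inf_Z K \<A> = bullet K (\<Union>\<A>)"

definition sup_Z :: "'z set set \<Rightarrow> 'z set"
  where "sup_Z \<A> = \<Inter>\<A>"

definition inf_X :: "'x set set \<Rightarrow> 'x set"
  where "inf_X \<B> = \<Inter>\<B>"

definition sup_X :: "'x::ab_group_add set \<Rightarrow> 'x set set \<Rightarrow> 'x set"
  where "sup_X D \<B> = bullet D (\<Union>\<B>)"

definition left_limit_Z :: "('x::ord \<Rightarrow> 'z set) \<Rightarrow> 'x \<Rightarrow> 'z set"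
  where "left_limit_Z F x = sup_Z {F v | v. v < x}"

definition right_limit_Z :: "'z::ab_group_add set \<Rightarrow> ('x::ord \<Rightarrow> 'z set) \<Rightarrow> 'x \<Rightarrow> 'z set"
  where "right_limit_Z K F x = inf_Z K {F v | v. x < v}"

definition left_limit_X :: "'x::ab_group_add set \<Rightarrow> ('z::ord \<Rightarrow> 'x set) \<Rightarrow> 'z \<Rightarrow> 'x set"
  where "left_limit_X D G z = sup_X D {G w | w. w < z}"

definition right_limit_X :: "('z::ord \<Rightarrow> 'x set) \<Rightarrow> 'z \<Rightarrow> 'x set"
  where "right_limit_X G z = inf_X {G w | w. z < w}"

definition increasing_left_cont_Z :: "'z::ab_group_add set \<Rightarrow> ('x::ord \<Rightarrow> 'z set) \<Rightarrow> bool"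
  where "increasing_left_cont_Z K F \<longleftrightarrow>
    F \<in> UNIV \<rightarrow> closed_sets K \<and> monotone (\<le>) (\<supseteq>) F \<and> F = left_limit_Z F"

definition increasing_right_cont_X :: "'x::ab_group_add set \<Rightarrow> ('z::ord \<Rightarrow> 'x set) \<Rightarrow> bool"
  where "increasing_right_cont_X D G \<longleftrightarrow>
    G \<in> UNIV \<rightarrow> closed_sets D \<and> monotone (\<le>) (\<subseteq>) G \<and> G = right_limit_X G"

definition set_inverse :: "('a \<Rightarrow> 'b set) \<Rightarrow> 'b \<Rightarrow> 'a set"
  where "set_inverse H b = {a. b \<in> H a}"

definition set_le_point :: "'z set \<Rightarrow> 'z \<Rightarrow> bool"
  where "set_le_point A z \<longleftrightarrow> z \<in> A"

definition set_less_point :: "'z::ord set \<Rightarrow> 'z \<Rightarrow> bool"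
  where "set_less_point A z \<longleftrightarrow> (\<exists>z'. z' < z \<and> z' \<in> A)"

definition point_le_set :: "'x \<Rightarrow> 'x set \<Rightarrow> bool"
  where "point_le_set x B \<longleftrightarrow> x \<in> B"

definition point_less_set :: "'x::ord \<Rightarrow> 'x set \<Rightarrow> bool"
  where "point_less_set x B \<longleftrightarrow> (\<exists>x'. x' > x \<and> x' \<in> B)"


subsection \<open>The lattice operations\<close>

definition pv_cone :: "'a::real_vector set \<Rightarrow> bool"
  where "pv_cone K \<longleftrightarrow> 0 \<in> K \<and> (\<forall>x\<in>K. \<forall>y\<in>K. x + y \<in> K) \<and> (\<forall>r>0. \<forall>x\<in>K. r *\<^sub>R x \<in> K)"

lemma pv_cone_nonneg: "pv_cone {k::'a::preordered_real_vector. 0 \<le> k}"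
  unfolding pv_cone_def
proof (intro conjI ballI allI impI)
  fix x y :: 'a assume "x \<in> {k. 0 \<le> k}" "y \<in> {k. 0 \<le> k}"
  then show "x + y \<in> {k. 0 \<le> k}"
    using pv_add_right_mono[of 0 x y] by (auto intro: order_trans)
next
  fix r :: real and x :: 'a assume "0 < r" "x \<in> {k. 0 \<le> k}"
  then show "r *\<^sub>R x \<in> {k. 0 \<le> k}" using pv_scaleR_mono[of r 0 x] by simp
qed simp

lemma pv_coneD:
  assumes "pv_cone K"
  shows "0 \<in> K" "x \<in> K \<Longrightarrow> y \<in> K \<Longrightarrow> x + y \<in> K" "0 < r \<Longrightarrow> x \<in> K \<Longrightarrow> r *\<^sub>R x \<in> K"
  using assms by (auto simp: pv_cone_def)

lemma pv_cone_uminus: "pv_cone C \<Longrightarrow> pv_cone (uminus ` C)"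
  by (simp add: pv_cone_def uminus_image_iff add.commute)

lemma strict_part_add:
  assumes K: "pv_cone K" and k: "k \<in> K" and h: "h \<in> strict_part K"
  shows "k + h \<in> strict_part K"
proof -
  have "- h \<in> K" if "- (k + h) \<in> K"
    using pv_coneD(2)[OF K that k] by simp
  then show ?thesis
    using pv_coneD(2)[OF K k, of h] h unfolding strict_part_iff by blast
qed

lemma strict_part_half:
  assumes K: "pv_cone K" and h: "h \<in> strict_part K"
  shows "(1/2) *\<^sub>R h \<in> strict_part K"
proof -
  have "- h \<in> K" if "- ((1/2) *\<^sub>R h) \<in> K"
    using pv_coneD(3)[OF K _ that, of 2] by simp
  moreover have "(1/2) *\<^sub>R h \<in> K"
    using pv_coneD(3)[OF K, of "1/2" h] h by (simp add: strict_part_iff)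
  ultimately show ?thesis
    using h unfolding strict_part_iff by blast
qed

lemma mono_sets_iff:
  "pv_cone K \<Longrightarrow> A \<in> mono_sets K \<longleftrightarrow> (\<forall>a\<in>A. \<forall>k\<in>K. a + k \<in> A)"
  using pv_coneD(1)[of K] by (force simp: mono_sets_def set_plus_def)

lemma bullet_iff: "z \<in> bullet K A \<longleftrightarrow> (\<forall>h\<in>strict_part K. z + h \<in> A)"
  by (auto simp: bullet_def set_plus_def)

lemma bullet_superset: "pv_cone K \<Longrightarrow> A \<in> mono_sets K \<Longrightarrow> A \<subseteq> bullet K A"
  by (auto simp: mono_sets_iff bullet_iff strict_part_def)

lemma bullet_mono: "A \<subseteq> B \<Longrightarrow> bullet K A \<subseteq> bullet K B"
  by (auto simp: bullet_iff subset_iff)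

lemma bullet_closed:
  assumes K: "pv_cone K" and A: "A \<in> mono_sets K"
  shows "bullet K A \<in> closed_sets K"
proof -
  have m: "bullet K A \<in> mono_sets K"
    unfolding mono_sets_iff[OF K]
  proof (intro ballI)
    fix a k assume "a \<in> bullet K A" "k \<in> K"
    then show "a + k \<in> bullet K A"
      using strict_part_add[OF K] by (simp add: bullet_iff add.assoc)
  qed
  have "z \<in> bullet K A" if "z \<in> bullet K (bullet K A)" for z
    unfolding bullet_iff
  proof
    fix h assume "h \<in> strict_part K"
    then have "z + (1/2) *\<^sub>R h + (1/2) *\<^sub>R h \<in> A"
      using that strict_part_half[OF K] unfolding bullet_iff by blast
    then show "z + h \<in> A" by (simp add: add.assoc flip: scaleR_left_distrib)
  qed
  then show ?thesis using m bullet_superset[OF K m] by (auto simp: closed_sets_def)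
qed

lemma Union_bullet_closed:
  assumes "pv_cone K" "\<A> \<subseteq> closed_sets K"
  shows "bullet K (\<Union>\<A>) \<in> closed_sets K" "A \<in> \<A> \<Longrightarrow> A \<subseteq> bullet K (\<Union>\<A>)"
proof -
  have "\<Union>\<A> \<in> mono_sets K"
    using assms(2) unfolding mono_sets_iff[OF assms(1)] closed_sets_def by blast
  then show "bullet K (\<Union>\<A>) \<in> closed_sets K" "A \<in> \<A> \<Longrightarrow> A \<subseteq> bullet K (\<Union>\<A>)"
    using bullet_closed bullet_superset assms(1) by blast+
qed

lemma Inter_closed:
  assumes "pv_cone K" "\<A> \<subseteq> closed_sets K"
  shows "\<Inter>\<A> \<in> closed_sets K"
proof -
  have "\<Inter>\<A> \<in> mono_sets K"
    using assms(2) unfolding mono_sets_iff[OF assms(1)] closed_sets_def by blast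
  moreover have "bullet K (\<Inter>\<A>) \<subseteq> A" if "A \<in> \<A>" for A
    using bullet_mono[of "\<Inter>\<A>" A K] that assms(2) by (auto simp: closed_sets_def)
  ultimately show ?thesis
    using bullet_superset[OF assms(1)] by (auto simp: closed_sets_def)
qed

lemma inf_Z_greatest:
  assumes "pv_cone K" "\<A> \<subseteq> closed_sets K"
  shows "inf_Z K \<A> \<in> closed_sets K" "A \<in> \<A> \<Longrightarrow> inf_Z K \<A> \<supseteq> A"
    "B \<in> closed_sets K \<Longrightarrow> (\<And>A. A \<in> \<A> \<Longrightarrow> B \<supseteq> A) \<Longrightarrow> B \<supseteq> inf_Z K \<A>"
  using Union_bullet_closed[OF assms] bullet_mono[of "\<Union>\<A>" B K]
  by (auto simp: inf_Z_def closed_sets_def)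

lemma sup_Z_least:
  assumes "pv_cone K" "\<A> \<subseteq> closed_sets K"
  shows "sup_Z \<A> \<in> closed_sets K" "A \<in> \<A> \<Longrightarrow> A \<supseteq> sup_Z \<A>"
    "B \<in> closed_sets K \<Longrightarrow> (\<And>A. A \<in> \<A> \<Longrightarrow> A \<supseteq> B) \<Longrightarrow> sup_Z \<A> \<supseteq> B"
  using Inter_closed[OF assms] by (auto simp: sup_Z_def)

lemma inf_X_greatest:
  assumes "pv_cone C" "\<B> \<subseteq> closed_sets (uminus ` C)"
  shows "inf_X \<B> \<in> closed_sets (uminus ` C)" "B \<in> \<B> \<Longrightarrow> inf_X \<B> \<subseteq> B"
    "A \<in> closed_sets (uminus ` C) \<Longrightarrow> (\<And>B. B \<in> \<B> \<Longrightarrow> A \<subseteq> B) \<Longrightarrow> A \<subseteq> inf_X \<B>"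
  using Inter_closed[OF pv_cone_uminus[OF assms(1)] assms(2)] by (auto simp: inf_X_def)

lemma sup_X_least:
  assumes "pv_cone C" "\<B> \<subseteq> closed_sets (uminus ` C)"
  shows "sup_X (uminus ` C) \<B> \<in> closed_sets (uminus ` C)"
    "B \<in> \<B> \<Longrightarrow> B \<subseteq> sup_X (uminus ` C) \<B>"
    "A \<in> closed_sets (uminus ` C) \<Longrightarrow> (\<And>B. B \<in> \<B> \<Longrightarrow> B \<subseteq> A) \<Longrightarrow> sup_X (uminus ` C) \<B> \<subseteq> A"
  using Union_bullet_closed[OF pv_cone_uminus[OF assms(1)] assms(2)]
    bullet_mono[of "\<Union>\<B>" A "uminus ` C"]
  by (auto simp: sup_X_def closed_sets_def)

end

theory Submission
  imports Defs
begin

text \<open>Write \<open>z \<in> F x\<close> as a relation between \<open>x\<close> and \<open>z\<close>.  That \<open>F\<close> is increasing and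
  left-continuous with values in \<open>\<K>(Z, K)\<close> says that this relation is preserved when \<open>x\<close> decreases
  or \<open>z\<close> increases, and that it holds at \<open>(x, z)\<close> if it holds at all \<open>(v, z)\<close> with \<open>v < x\<close>, or at
  all \<open>(x, w)\<close> with \<open>w > z\<close>.  For \<open>F\<^sup>-\<^sup>1\<close>, being increasing and right-continuous with values in
  \<open>\<K>(X, -C)\<close> unfolds to the very same four conditions: membership in \<open>\<P>\<close> and monotonicity swap
  roles, as do the condition \<open>A\<^sup>\<bullet> = A\<close> and one-sided continuity.\<close>

lemma less_iff_strict_part:
  fixes x y :: "'a::preordered_real_vector"
  shows "x < y \<longleftrightarrow> y - x \<in> strict_part {k. 0 \<le> k}"
  by (simp add: pv_less_iff strict_part_def)

text \<open>The midpoint leaves the gap \<open>(1/2) *\<^sub>R (y - x)\<close> on both sides, and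
  halving preserves \<open>strict_part\<close>. This density lets a strict inequality be split in
  the comparison of the two limits.\<close>

lemma less_midpoint:
  fixes x y :: "'a::preordered_real_vector"
  assumes "x < y"
  obtains m where "x < m" "m < y"
proof
  have h: "(1/2) *\<^sub>R (y - x) \<in> strict_part {k. 0 \<le> k}"
    using assms by (intro strict_part_half pv_cone_nonneg) (simp add: less_iff_strict_part)
  show "x < x + (1/2) *\<^sub>R (y - x)"
    using h by (simp add: less_iff_strict_part)
  have "y - (x + (1/2) *\<^sub>R (y - x)) = (1/2) *\<^sub>R (y - x)"
    using scaleR_left_distrib[of "1/2" "1/2" "y - x"] by (simp add: algebra_simps)
  then show "x + (1/2) *\<^sub>R (y - x) < y"
    using h by (simp add: less_iff_strict_part)
qed

text \<open>Quantifying over larger points instead of over increments gives the bullet the same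
  shape as a one-sided limit, so that closedness and continuity become comparable.\<close>

lemma bullet_nonneg_iff:
  fixes A :: "'a::preordered_real_vector set"
  shows "z \<in> bullet {k. 0 \<le> k} A \<longleftrightarrow> (\<forall>w>z. w \<in> A)"
proof
  assume "z \<in> bullet {k. 0 \<le> k} A"
  then have "z + (w - z) \<in> A" if "z < w" for w
    using that unfolding bullet_iff less_iff_strict_part by blast
  then show "\<forall>w>z. w \<in> A" by simp
next
  assume "\<forall>w>z. w \<in> A"
  then show "z \<in> bullet {k. 0 \<le> k} A"
    by (simp add: bullet_iff less_iff_strict_part)
qed

lemma bullet_uminus_nonneg_iff:
  fixes B :: "'a::preordered_real_vector set"
  shows "x \<in> bullet (uminus ` {c. 0 \<le> c}) B \<longleftrightarrow> (\<forall>v<x. v \<in> B)"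
proof
  assume "x \<in> bullet (uminus ` {c. 0 \<le> c}) B"
  then have "x - (x - v) \<in> B" if "v < x" for v
    using that unfolding bullet_uminus less_iff_strict_part by blast
  then show "\<forall>v<x. v \<in> B" by simp
next
  assume "\<forall>v<x. v \<in> B"
  then show "x \<in> bullet (uminus ` {c. 0 \<le> c}) B"
    by (simp add: bullet_uminus less_iff_strict_part)
qed

lemma mono_sets_nonneg_iff:
  fixes A :: "'a::preordered_real_vector set"
  shows "A \<in> mono_sets {k. 0 \<le> k} \<longleftrightarrow> (\<forall>z\<in>A. \<forall>w\<ge>z. w \<in> A)"
  unfolding mono_sets_iff[OF pv_cone_nonneg]
proof (intro iffI ballI allI impI)
  fix z w :: 'a assume *: "\<forall>z\<in>A. \<forall>k\<in>{k. 0 \<le> k}. z + k \<in> A" "z \<in> A" and "z \<le> w"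
  have "w - z \<in> {k. 0 \<le> k}" using \<open>z \<le> w\<close> by (rule pv_le_iff_cone[THEN iffD1])
  with * have "z + (w - z) \<in> A" by blast
  then show "w \<in> A" by simp
next
  fix z k :: 'a assume *: "\<forall>z\<in>A. \<forall>w\<ge>z. w \<in> A" "z \<in> A" and "k \<in> {k. 0 \<le> k}"
  have "z \<le> z + k" using \<open>k \<in> _\<close> pv_le_iff_cone[of z "z + k"] by simp
  with * show "z + k \<in> A" by blast
qed

lemma mono_sets_uminus_nonneg_iff:
  fixes B :: "'a::preordered_real_vector set"
  shows "B \<in> mono_sets (uminus ` {c. 0 \<le> c}) \<longleftrightarrow> (\<forall>x\<in>B. \<forall>v\<le>x. v \<in> B)"
  unfolding mono_sets_iff[OF pv_cone_uminus[OF pv_cone_nonneg]]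
proof (intro iffI ballI allI impI)
  fix x v :: 'a assume *: "\<forall>x\<in>B. \<forall>c\<in>uminus ` {c. 0 \<le> c}. x + c \<in> B" "x \<in> B" and "v \<le> x"
  have "v - x \<in> uminus ` {c. 0 \<le> c}"
    using \<open>v \<le> x\<close> pv_le_iff_cone[of v x] by (simp add: uminus_image_iff)
  with * have "x + (v - x) \<in> B" by blast
  then show "v \<in> B" by simp
next
  fix x c :: 'a assume *: "\<forall>x\<in>B. \<forall>v\<le>x. v \<in> B" "x \<in> B" and "c \<in> uminus ` {c. 0 \<le> c}"
  have "x + c \<le> x"
    using \<open>c \<in> _\<close> pv_le_iff_cone[of "x + c" x] by (simp add: uminus_image_iff)
  with * show "x + c \<in> B" by blast
qed

text \<open>An upward closed set always lies in its bullet, so the fixed-point equation reduces to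
  the reverse inclusion.\<close>

lemma closed_sets_nonneg_iff:
  fixes A :: "'a::preordered_real_vector set"
  shows "A \<in> closed_sets {k. 0 \<le> k} \<longleftrightarrow>
    (\<forall>z\<in>A. \<forall>w\<ge>z. w \<in> A) \<and> (\<forall>z. (\<forall>w>z. w \<in> A) \<longrightarrow> z \<in> A)"
proof -
  have "bullet {k. 0 \<le> k} A = A \<longleftrightarrow> (\<forall>z. (\<forall>w>z. w \<in> A) \<longrightarrow> z \<in> A)"
    if "\<forall>z\<in>A. \<forall>w\<ge>z. w \<in> A"
    using that by (auto simp: set_eq_iff bullet_nonneg_iff dest: less_imp_le)
  then show ?thesis
    \<comment> \<open>\<open>conj_cong\<close> makes the first conjunct available as the hypothesis
      of the equivalence just shown.\<close>
    unfolding closed_sets_def mem_Collect_eq mono_sets_nonneg_iff by (rule conj_cong[OF refl])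
qed

lemma closed_sets_uminus_nonneg_iff:
  fixes B :: "'a::preordered_real_vector set"
  shows "B \<in> closed_sets (uminus ` {c. 0 \<le> c}) \<longleftrightarrow>
    (\<forall>x\<in>B. \<forall>v\<le>x. v \<in> B) \<and> (\<forall>x. (\<forall>v<x. v \<in> B) \<longrightarrow> x \<in> B)"
proof -
  have "bullet (uminus ` {c. 0 \<le> c}) B = B \<longleftrightarrow> (\<forall>x. (\<forall>v<x. v \<in> B) \<longrightarrow> x \<in> B)"
    if "\<forall>x\<in>B. \<forall>v\<le>x. v \<in> B"
    using that by (auto simp: set_eq_iff bullet_uminus_nonneg_iff dest: less_imp_le)
  then show ?thesis
    unfolding closed_sets_def mem_Collect_eq mono_sets_uminus_nonneg_iff
    by (rule conj_cong[OF refl])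
qed

lemma mem_set_inverse_iff [simp]: "a \<in> set_inverse H b \<longleftrightarrow> b \<in> H a"
  by (simp add: set_inverse_def)

text \<open>Inversion transposes a relation, hence is an involution; this is claim (2).\<close>

lemma set_inverse_set_inverse [simp]: "set_inverse (set_inverse H) = H"
  by (rule ext) (simp add: set_inverse_def)

text \<open>Suprema for \<supseteq> are plain intersections, so no bullet enters the left limit.
  Monotonicity already puts \<open>F x\<close> inside that intersection, leaving one implication for
  left-continuity.\<close>

lemma increasing_left_cont_Z_iff:
  fixes F :: "'x::preordered_real_vector \<Rightarrow> 'z::preordered_real_vector set"
  shows "increasing_left_cont_Z {k. 0 \<le> k} F \<longleftrightarrow>
    (\<forall>x. \<forall>z\<in>F x. \<forall>w\<ge>z. w \<in> F x) \<and> (\<forall>x z. (\<forall>w>z. w \<in> F x) \<longrightarrow> z \<in> F x) \<and>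
    (\<forall>x z. z \<in> F x \<longrightarrow> (\<forall>v\<le>x. z \<in> F v)) \<and> (\<forall>x z. (\<forall>v<x. z \<in> F v) \<longrightarrow> z \<in> F x)"
proof -
  have mono: "monotone (\<le>) (\<supseteq>) F \<longleftrightarrow> (\<forall>x z. z \<in> F x \<longrightarrow> (\<forall>v\<le>x. z \<in> F v))"
    unfolding monotone_def by blast
  have "F = left_limit_Z F \<longleftrightarrow> (\<forall>x z. (\<forall>v<x. z \<in> F v) \<longrightarrow> z \<in> F x)"
    if "monotone (\<le>) (\<supseteq>) F"
  proof -
    have "z \<in> F v" if "z \<in> F x" "v < x" for x v z
      using monotoneD[OF \<open>monotone (\<le>) (\<supseteq>) F\<close> less_imp_le[OF that(2)]] that(1) by blast
    moreover have "F = left_limit_Z F \<longleftrightarrow> (\<forall>x z. z \<in> F x \<longleftrightarrow> (\<forall>v<x. z \<in> F v))"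
      unfolding fun_eq_iff left_limit_Z_def sup_Z_def set_eq_iff by blast
    ultimately show ?thesis by metis
  qed
  then have "increasing_left_cont_Z {k. 0 \<le> k} F \<longleftrightarrow>
    (\<forall>x. F x \<in> closed_sets {k. 0 \<le> k}) \<and> monotone (\<le>) (\<supseteq>) F \<and>
    (\<forall>x z. (\<forall>v<x. z \<in> F v) \<longrightarrow> z \<in> F x)"
    unfolding increasing_left_cont_Z_def Pi_iff by auto
  then show ?thesis
    unfolding closed_sets_nonneg_iff mono by (simp only: all_conj_distrib conj_assoc)
qed

text \<open>For \<subseteq> it is the infimum that is a plain intersection, which is why
  right-continuity takes the place of left-continuity here.\<close>

lemma increasing_right_cont_X_iff:
  fixes G :: "'z::preordered_real_vector \<Rightarrow> 'x::preordered_real_vector set"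
  shows "increasing_right_cont_X (uminus ` {c. 0 \<le> c}) G \<longleftrightarrow>
    (\<forall>z. \<forall>x\<in>G z. \<forall>v\<le>x. v \<in> G z) \<and> (\<forall>z x. (\<forall>v<x. v \<in> G z) \<longrightarrow> x \<in> G z) \<and>
    (\<forall>z x. x \<in> G z \<longrightarrow> (\<forall>w\<ge>z. x \<in> G w)) \<and> (\<forall>z x. (\<forall>w>z. x \<in> G w) \<longrightarrow> x \<in> G z)"
proof -
  have mono: "monotone (\<le>) (\<subseteq>) G \<longleftrightarrow> (\<forall>z x. x \<in> G z \<longrightarrow> (\<forall>w\<ge>z. x \<in> G w))"
    unfolding monotone_def by blast
  have "G = right_limit_X G \<longleftrightarrow> (\<forall>z x. (\<forall>w>z. x \<in> G w) \<longrightarrow> x \<in> G z)"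
    if "monotone (\<le>) (\<subseteq>) G"
  proof -
    have "x \<in> G w" if "x \<in> G z" "z < w" for z w x
      using monotoneD[OF \<open>monotone (\<le>) (\<subseteq>) G\<close> less_imp_le[OF that(2)]] that(1) by blast
    moreover have "G = right_limit_X G \<longleftrightarrow> (\<forall>z x. x \<in> G z \<longleftrightarrow> (\<forall>w>z. x \<in> G w))"
      unfolding fun_eq_iff right_limit_X_def inf_X_def set_eq_iff by blast
    ultimately show ?thesis by metis
  qed
  then have "increasing_right_cont_X (uminus ` {c. 0 \<le> c}) G \<longleftrightarrow>
    (\<forall>z. G z \<in> closed_sets (uminus ` {c. 0 \<le> c})) \<and> monotone (\<le>) (\<subseteq>) G \<and>
    (\<forall>z x. (\<forall>w>z. x \<in> G w) \<longrightarrow> x \<in> G z)"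
    unfolding increasing_right_cont_X_def Pi_iff by auto
  then show ?thesis
    unfolding closed_sets_uminus_nonneg_iff mono by (simp only: all_conj_distrib conj_assoc)
qed

text \<open>Transposition exchanges the first two conditions of one list with the last two of the
  other.\<close>

lemma increasing_right_cont_X_set_inverse_iff:
  fixes F :: "'x::preordered_real_vector \<Rightarrow> 'z::preordered_real_vector set"
  shows "increasing_right_cont_X (uminus ` {c. 0 \<le> c}) (set_inverse F) \<longleftrightarrow>
    increasing_left_cont_Z {k. 0 \<le> k} F"
  unfolding increasing_right_cont_X_iff increasing_left_cont_Z_iff mem_set_inverse_iff Ball_def
  by blast

text \<open>This limit is the bullet of a union, so the witness \<open>v\<close> may depend on
  \<open>w\<close>.\<close>

lemma mem_right_limit_Z_iff:
  fixes F :: "'x::ord \<Rightarrow> 'z::preordered_real_vector set"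
  shows "z \<in> right_limit_Z {k. 0 \<le> k} F x \<longleftrightarrow> (\<forall>w>z. \<exists>v>x. w \<in> F v)"
  unfolding right_limit_Z_def inf_Z_def bullet_nonneg_iff by blast

lemma mem_left_limit_X_iff:
  fixes G :: "'z::ord \<Rightarrow> 'x::preordered_real_vector set"
  shows "x \<in> left_limit_X (uminus ` {c. 0 \<le> c}) G z \<longleftrightarrow> (\<forall>v<x. \<exists>w<z. v \<in> G w)"
  unfolding left_limit_X_def sup_X_def bullet_uminus_nonneg_iff by blast

text \<open>Evaluating the defining condition of one limit at the midpoint of the given strict inequality
  produces a witness for the other limit.\<close>

lemma right_limit_less_iff_less_left_limit:
  fixes F :: "'x::preordered_real_vector \<Rightarrow> 'z::preordered_real_vector set"
  assumes F: "increasing_left_cont_Z {k. 0 \<le> k} F"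
  shows "set_less_point (right_limit_Z {k. 0 \<le> k} F x) z \<longleftrightarrow>
    point_less_set x (left_limit_X (uminus ` {c. 0 \<le> c}) (set_inverse F) z)"
    (is "?L \<longleftrightarrow> ?R")
proof -
  have up: "w \<in> F y" if "u \<in> F y" "u < w" for u w y
    using F that unfolding increasing_left_cont_Z_iff by (blast intro: less_imp_le)
  have down: "w \<in> F u" if "w \<in> F y" "u < y" for u w y
    using F that unfolding increasing_left_cont_Z_iff by (blast intro: less_imp_le)
  show ?thesis
  proof
    assume ?L
    then obtain z' where "z' < z" and z': "\<forall>w>z'. \<exists>v>x. w \<in> F v"
      unfolding set_less_point_def mem_right_limit_Z_iff by blast
    obtain m where "z' < m" "m < z" using \<open>z' < z\<close> by (rule less_midpoint)
    then obtain v where "v > x" "m \<in> F v" using z' by blast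
    \<comment> \<open>The point above \<open>x\<close> is \<open>v\<close>: by \<open>down\<close>,
      the value \<open>m\<close> lies in \<open>F u\<close> for every \<open>u < v\<close>, and
      \<open>m < z\<close>.\<close>
    then show ?R
      using \<open>m < z\<close> down unfolding point_less_set_def mem_left_limit_X_iff mem_set_inverse_iff
      by blast
  next
    assume ?R
    then obtain x' where "x < x'" and x': "\<forall>v<x'. \<exists>w<z. w \<in> F v"
      unfolding point_less_set_def mem_left_limit_X_iff mem_set_inverse_iff by blast
    obtain m where "x < m" "m < x'" using \<open>x < x'\<close> by (rule less_midpoint)
    then obtain w where "w < z" "w \<in> F m" using x' by blast
    \<comment> \<open>The point below \<open>z\<close> is \<open>w\<close>: by \<open>up\<close>,
      every larger value lies in \<open>F m\<close>, and \<open>x < m\<close>.\<close>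
    then show ?L
      using \<open>x < m\<close> up unfolding set_less_point_def mem_right_limit_Z_iff by blast
  qed
qed

theorem theorem2p2:
  fixes C :: "'x::preordered_real_vector set"
    and K :: "'z::preordered_real_vector set"
  assumes "C = {c. c \<ge> 0}" and "K = {k. k \<ge> 0}"
    and "strict_part C \<noteq> {}" and "strict_part K \<noteq> {}"
  shows
    "((\<forall>F :: 'x \<Rightarrow> 'z set. increasing_left_cont_Z K F \<longrightarrow>
          increasing_right_cont_X (uminus ` C) (set_inverse F)) \<and>
      (\<forall>G :: 'z \<Rightarrow> 'x set. increasing_right_cont_X (uminus ` C) G \<longrightarrow>
          increasing_left_cont_Z K (set_inverse G))) \<and>
     (\<forall>(F :: 'x \<Rightarrow> 'z set) (G :: 'z \<Rightarrow> 'x set).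
        increasing_left_cont_Z K F \<and> increasing_right_cont_X (uminus ` C) G \<longrightarrow>
          F = set_inverse (set_inverse F) \<and> G = set_inverse (set_inverse G)) \<and>
     (\<forall>(F :: 'x \<Rightarrow> 'z set) (G :: 'z \<Rightarrow> 'x set).
        increasing_left_cont_Z K F \<and> increasing_right_cont_X (uminus ` C) G \<and>
        G = set_inverse F \<longrightarrow>
          (\<forall>x z. (set_le_point (F x) z \<longleftrightarrow> point_le_set x (G z)) \<and>
                 (set_less_point (right_limit_Z K F x) z \<longleftrightarrow>
                    point_less_set x (left_limit_X (uminus ` C) G z))))"
proof -
  \<comment> \<open>The converse half of (1) is the same equivalence read at
    \<open>set_inverse G\<close>, whose inverse is \<open>G\<close>.\<close>
  have "increasing_left_cont_Z K (set_inverse G)"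
    if "increasing_right_cont_X (uminus ` C) G" for G :: "'z \<Rightarrow> 'x set"
    using increasing_right_cont_X_set_inverse_iff[of "set_inverse G"] that assms(1,2) by simp
  then show ?thesis
    using assms(1,2)
    by (auto simp: increasing_right_cont_X_set_inverse_iff right_limit_less_iff_less_left_limit
        set_le_point_def point_le_set_def)
qed

end
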